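(* Let $(X,d)$ be a metric space and let $a$ be a limit point of $X$ (with $a\in X$). Then the following are equivalent: (A) for every normalizing sequence $\tilde r$ there is a unique pretangent space $\Omega_{a,\tilde r}$ to $X$ at $a$; (B) the following three conditions are satisfied simultaneously: (i) $$\lim_{k\to 1}\ \limsup_{r\to 0}\frac{\operatorname{diam}(A_a(r,k))}{r}=0,\qquad r\in\,]0,\infty[\,,\ k\in[1,\infty[\,.$$ (ii) For every $\varepsilon\in\,]0,1[\,$, $$\lim_{\substack{(t,g)\to(0,0)\\ (t,g)\in R^2_\varepsilon}}\frac{\Delta(S_a(g),S_a(t))}{\delta(S_a(g),S_a(t))}=1 .$$ (iii) For every $\varepsilon\in\,]0,1[\,$: if $\{(q_n,t_n)\}_{n\in\mathbb N}$ is a sequence such that $(q_n,t_n)\in R^2_\varepsilon$ for all $n\in\mathbb N$, $\lim_{n\to\infty}(q_n,t_n)=(0,0)$, and the limit $\lim_{n\to\infty}\frac{q_n}{t_n}=c_0\in[0,\infty]$ exists, then there exists a finite limit $$\lim_{n\to\infty}\frac{\Delta(S_a(q_n),S_a(t_n))}{|q_n-t_n|}.$$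
   Context: Let $(X,d)$ be a metric space with a marked point $a\in X$. A normalizing sequence is a sequence $\tilde r=\{r_n\}_{n\in\mathbb N}$ of positive reals with $r_n\to0$. Let $\tilde X$ be the set of all sequences of points of $X$, and $\tilde a:=\{a,a,\dots\}$. Two sequences $\tilde x=\{x_n\},\tilde y=\{y_n\}\in\tilde X$ are mutually stable (w.r.t. $\tilde r$) if the finite limit $\tilde d_{\tilde r}(\tilde x,\tilde y):=\lim_{n\to\infty} d(x_n,y_n)/r_n$ exists. A family $\tilde F\subseteq\tilde X$ is self-stable (w.r.t. $\tilde r$) if every two of its elements are mutually stable; it is maximal self-stable if it is self-stable and for every $\tilde z\in\tilde X$ either $\tilde z\in\tilde F$ or there is $\tilde x\in\tilde F$ such that $\tilde x$ and $\tilde z$ are not mutually stable. $\tilde X_{a,\tilde r}$ denotes a maximal self-stable family (w.r.t. $\tilde r$) containing $\tilde a$ (such families always exist). On it $\tilde d_{\tilde r}$ is a pseudometric; the corresponding pretangent space $\Omega_{a,\tilde r}$ to $X$ at $a$ w.r.t. $\tilde r$ is the metric identification of $(\tilde X_{a,\tilde r},\tilde d_{\tilde r})$, i.e. the set of equivalence classes of the relation $\tilde d_{\tilde r}(\tilde x,\tilde y)=0$ with the induced metric. Uniqueness of the pretangent space is in the set-theoretic sense, equivalently: for the given $\tilde r$ there is exactly one maximal self-stable family $\tilde X_{a,\tilde r}$ containing $\tilde a$. Further notation: for nonempty $C,D\subseteq X$, $\Delta(C,D):=\sup\{d(x,y):x\in C,y\in D\}$ and $\delta(C,D):=\inf\{d(x,y):x\in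 C,y\in D\}$. For $r>0$, $k\ge1$: $A_a(r,k):=\{x\in X: r/k\le d(x,a)\le rk\}$, with the convention $\operatorname{diam}(\emptyset)=0$. For $r\ge 0$: $S_a(r):=\{x\in X:d(x,a)=r\}$. $R_{a,X}:=\{r\in[0,\infty[\,:S_a(r)\ne\emptyset\}$. For $\varepsilon\in\,]0,1[\,$: $R^2_\varepsilon:=\{(r,t)\in R_{a,X}\times R_{a,X}: r\ne0\ne t \text{ and } |r/t-1|\ge\varepsilon\}$. *)

theory Defs
  imports "HOL-Analysis.Analysis"
begin

(* The metric space (X, d) is a type of class metric_space with its distance dist;
   points of the set of all sequences in X are functions nat => 'a. *)

definition normalizing :: "(nat \<Rightarrow> real) \<Rightarrow> bool" where
  "normalizing r \<longleftrightarrow> (\<forall>n. r n > 0) \<and> r \<longlonglongrightarrow> 0"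

definition mutually_stable ::
  "(nat \<Rightarrow> real) \<Rightarrow> (nat \<Rightarrow> 'a::metric_space) \<Rightarrow> (nat \<Rightarrow> 'a) \<Rightarrow> bool" where
  "mutually_stable r x y \<longleftrightarrow> convergent (\<lambda>n. dist (x n) (y n) / r n)"

(* Meaningful for mutually stable x and y only. *)
definition stable_dist ::
  "(nat \<Rightarrow> real) \<Rightarrow> (nat \<Rightarrow> 'a::metric_space) \<Rightarrow> (nat \<Rightarrow> 'a) \<Rightarrow> real" where
  "stable_dist r x y = lim (\<lambda>n. dist (x n) (y n) / r n)"

definition self_stable :: "(nat \<Rightarrow> real) \<Rightarrow> (nat \<Rightarrow> 'a::metric_space) set \<Rightarrow> bool" where
  "self_stable r F \<longleftrightarrow> (\<forall>x\<in>F. \<forall>y\<in>F. mutually_stable r x y)"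

definition maximal_self_stable ::
  "(nat \<Rightarrow> real) \<Rightarrow> (nat \<Rightarrow> 'a::metric_space) set \<Rightarrow> bool" where
  "maximal_self_stable r F \<longleftrightarrow>
     self_stable r F \<and> (\<forall>z. z \<in> F \<or> (\<exists>x\<in>F. \<not> mutually_stable r x z))"

definition zero_dist_rel ::
  "(nat \<Rightarrow> real) \<Rightarrow> (nat \<Rightarrow> 'a::metric_space) set \<Rightarrow> ((nat \<Rightarrow> 'a) \<times> (nat \<Rightarrow> 'a)) set" where
  "zero_dist_rel r F = {(x, y). x \<in> F \<and> y \<in> F \<and> stable_dist r x y = 0}"

(* The image of C \<times> D is a singleton when C and D are equivalence classes. The value 0 off
   the carrier is a convention: the abstract type of metric spaces has total distances. *)
definition class_dist ::
  "(nat \<Rightarrow> real) \<Rightarrow> (nat \<Rightarrow> 'a::metric_space) set \<Rightarrow> (nat \<Rightarrow> 'a) set \<Rightarrow> (nat \<Rightarrow> 'a) set \<Rightarrow> real" where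
  "class_dist r F C D =
     (if C \<in> F // zero_dist_rel r F \<and> D \<in> F // zero_dist_rel r F
      then the_elem ((\<lambda>(x, y). stable_dist r x y) ` (C \<times> D)) else 0)"

definition metric_identification ::
  "(nat \<Rightarrow> real) \<Rightarrow> (nat \<Rightarrow> 'a::metric_space) set \<Rightarrow> (nat \<Rightarrow> 'a) set metric" where
  "metric_identification r F = metric (F // zero_dist_rel r F, class_dist r F)"

definition is_pretangent_space ::
  "'a::metric_space \<Rightarrow> (nat \<Rightarrow> real) \<Rightarrow> (nat \<Rightarrow> 'a) set metric \<Rightarrow> bool" where
  "is_pretangent_space a r \<Omega> \<longleftrightarrow>
     (\<exists>F. maximal_self_stable r F \<and> (\<lambda>_. a) \<in> F \<and> \<Omega> = metric_identification r F)"

(* Agrees with the supremum in [0, \<infinity>] whenever C and D are nonempty and bounded. *)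
definition sup_dist :: "'a::metric_space set \<Rightarrow> 'a set \<Rightarrow> real" where
  "sup_dist C D = (SUP (x, y)\<in>C \<times> D. dist x y)"

definition annulus :: "'a::metric_space \<Rightarrow> real \<Rightarrow> real \<Rightarrow> 'a set" where
  "annulus a r k = {x. r / k \<le> dist x a \<and> dist x a \<le> r * k}"

definition dist_sphere :: "'a::metric_space \<Rightarrow> real \<Rightarrow> 'a set" where
  "dist_sphere a r = {x. dist x a = r}"

definition radii :: "'a::metric_space \<Rightarrow> real set" where
  "radii a = {r. r \<ge> 0 \<and> dist_sphere a r \<noteq> {}}"

definition separated_radii :: "'a::metric_space \<Rightarrow> real \<Rightarrow> (real \<times> real) set" where
  "separated_radii a \<epsilon> =
     {(r, t). r \<in> radii a \<and> t \<in> radii a \<and> r \<noteq> 0 \<and> t \<noteq> 0 \<and> \<bar>r / t - 1\<bar> \<ge> \<epsilon>}"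


subsection \<open>The metric identification is a metric space\<close>

lemma stable_dist_tendsto:
  "mutually_stable r x y \<Longrightarrow> (\<lambda>n. dist (x n) (y n) / r n) \<longlonglongrightarrow> stable_dist r x y"
  by (simp add: mutually_stable_def stable_dist_def convergent_LIMSEQ_iff)

lemma stable_dist_self [simp]: "stable_dist r x x = 0"
  by (simp add: stable_dist_def)

lemma stable_dist_commute: "stable_dist r x y = stable_dist r y x"
  by (simp add: stable_dist_def dist_commute)

lemma stable_dist_nonneg:
  assumes "normalizing r" "mutually_stable r x y"
  shows "stable_dist r x y \<ge> 0"
  by (rule LIMSEQ_le_const[OF stable_dist_tendsto[OF assms(2)]])
     (use assms(1) in \<open>auto simp: normalizing_def less_imp_le\<close>)

lemma stable_dist_triangle:
  assumes "normalizing r" "mutually_stable r x y" "mutually_stable r y z" "mutually_stable r x z"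
  shows "stable_dist r x z \<le> stable_dist r x y + stable_dist r y z"
proof (rule LIMSEQ_le)
  show "(\<lambda>n. dist (x n) (z n) / r n) \<longlonglongrightarrow> stable_dist r x z"
    by (rule stable_dist_tendsto[OF assms(4)])
  show "(\<lambda>n. dist (x n) (y n) / r n + dist (y n) (z n) / r n)
          \<longlonglongrightarrow> stable_dist r x y + stable_dist r y z"
    by (intro tendsto_add stable_dist_tendsto assms)
  have "dist (x n) (z n) / r n \<le> dist (x n) (y n) / r n + dist (y n) (z n) / r n" for n
    using assms(1) dist_triangle[of "x n" "z n" "y n"]
    by (simp add: normalizing_def divide_right_mono less_imp_le flip: add_divide_distrib)
  then show "\<exists>N. \<forall>n\<ge>N. dist (x n) (z n) / r n
      \<le> dist (x n) (y n) / r n + dist (y n) (z n) / r n"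
    by blast
qed

lemma equiv_zero_dist_rel:
  assumes "normalizing r" "self_stable r F"
  shows "equiv F (zero_dist_rel r F)"
proof (rule equivI)
  show "trans (zero_dist_rel r F)"
  proof (rule transI)
    fix x y z assume *: "(x, y) \<in> zero_dist_rel r F" "(y, z) \<in> zero_dist_rel r F"
    then have ms: "mutually_stable r x y" "mutually_stable r y z" "mutually_stable r x z"
      using assms(2) by (auto simp: zero_dist_rel_def self_stable_def)
    show "(x, z) \<in> zero_dist_rel r F"
      using * stable_dist_triangle[OF assms(1) ms] stable_dist_nonneg[OF assms(1) ms(3)]
      by (auto simp: zero_dist_rel_def)
  qed
qed (auto simp: refl_on_def sym_def zero_dist_rel_def stable_dist_commute)

lemma class_dist_eq:
  assumes "normalizing r" "self_stable r F" "x \<in> F" "y \<in> F"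
  shows "class_dist r F (zero_dist_rel r F `` {x}) (zero_dist_rel r F `` {y}) = stable_dist r x y"
proof -
  let ?R = "zero_dist_rel r F"
  have ms: "mutually_stable r u v" if "u \<in> F" "v \<in> F" for u v
    using assms(2) that by (auto simp: self_stable_def)
  have const: "stable_dist r u v = stable_dist r x y" if "u \<in> ?R `` {x}" "v \<in> ?R `` {y}" for u v
  proof -
    have uv: "u \<in> F" "v \<in> F" "stable_dist r x u = 0" "stable_dist r y v = 0"
      using that by (auto simp: zero_dist_rel_def)
    have "stable_dist r u v \<le> stable_dist r u x + stable_dist r x v"
         "stable_dist r x v \<le> stable_dist r x y + stable_dist r y v"
         "stable_dist r x y \<le> stable_dist r x u + stable_dist r u y"
         "stable_dist r u y \<le> stable_dist r u v + stable_dist r v y"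
      by (intro stable_dist_triangle assms(1) ms uv assms(3,4))+
    with uv(3,4) show ?thesis
      by (simp add: stable_dist_commute)
  qed
  have mem: "(x, y) \<in> ?R `` {x} \<times> ?R `` {y}"
    using assms(3,4) by (simp add: zero_dist_rel_def)
  have "(\<lambda>(u, v). stable_dist r u v) ` (?R `` {x} \<times> ?R `` {y}) =
        (\<lambda>_. stable_dist r x y) ` (?R `` {x} \<times> ?R `` {y})"
  proof (rule image_cong[OF refl])
    fix p assume "p \<in> ?R `` {x} \<times> ?R `` {y}"
    then obtain u v where "p = (u, v)" "u \<in> ?R `` {x}" "v \<in> ?R `` {y}"
      by (rule SigmaE)
    with const show "(case p of (u, v) \<Rightarrow> stable_dist r u v) = stable_dist r x y"
      by (simp only: prod.case)
  qed
  also have "\<dots> = {stable_dist r x y}"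
    using mem by (rule image_constant)
  finally have "the_elem ((\<lambda>(u, v). stable_dist r u v) ` (?R `` {x} \<times> ?R `` {y})) =
        stable_dist r x y"
    by (simp only: the_elem_eq)
  then show ?thesis
    unfolding class_dist_def using assms(3,4) by (simp only: quotientI simp_thms if_True)
qed

lemma Metric_space_identification:
  assumes "normalizing r" "self_stable r F"
  shows "Metric_space (F // zero_dist_rel r F) (class_dist r F)"
proof
  let ?Q = "F // zero_dist_rel r F"
  have ms: "mutually_stable r u v" if "u \<in> F" "v \<in> F" for u v
    using assms(2) that by (auto simp: self_stable_def)
  note eq = class_dist_eq[OF assms]
  have rep: "\<exists>x\<in>F. C = zero_dist_rel r F `` {x}" if "C \<in> ?Q" for C
    using that by (auto simp: quotient_def)
  show "0 \<le> class_dist r F C D" for C D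
  proof (cases "C \<in> ?Q \<and> D \<in> ?Q")
    case True
    with rep obtain x y where
      "x \<in> F" "y \<in> F" "C = zero_dist_rel r F `` {x}" "D = zero_dist_rel r F `` {y}"
      by meson
    then show ?thesis
      by (simp add: eq stable_dist_nonneg[OF assms(1) ms])
  next
    case False
    then show ?thesis
      unfolding class_dist_def by (simp only: if_False order.refl)
  qed
  show "class_dist r F C D = class_dist r F D C" for C D
  proof (cases "C \<in> ?Q \<and> D \<in> ?Q")
    case True
    with rep obtain x y where
      "x \<in> F" "y \<in> F" "C = zero_dist_rel r F `` {x}" "D = zero_dist_rel r F `` {y}"
      by meson
    then show ?thesis
      by (simp add: eq stable_dist_commute[of r x y])
  next
    case False
    then have "\<not> (D \<in> ?Q \<and> C \<in> ?Q)"
      by blast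
    with False show ?thesis
      unfolding class_dist_def by (simp only: if_False)
  qed
  show "class_dist r F C D = 0 \<longleftrightarrow> C = D" if CD: "C \<in> ?Q" "D \<in> ?Q" for C D
  proof -
    obtain x y where *:
      "x \<in> F" "y \<in> F" "C = zero_dist_rel r F `` {x}" "D = zero_dist_rel r F `` {y}"
      using CD rep by meson
    then have "class_dist r F C D = 0 \<longleftrightarrow> (x, y) \<in> zero_dist_rel r F"
      by (simp add: eq) (simp add: zero_dist_rel_def)
    also have "\<dots> \<longleftrightarrow> C = D"
      using eq_equiv_class_iff[OF equiv_zero_dist_rel[OF assms] *(1,2)] *(3,4) by simp
    finally show ?thesis .
  qed
  show "class_dist r F C E \<le> class_dist r F C D + class_dist r F D E"
    if CDE: "C \<in> ?Q" "D \<in> ?Q" "E \<in> ?Q" for C D E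
  proof -
    obtain x y z where "x \<in> F" "y \<in> F" "z \<in> F" "C = zero_dist_rel r F `` {x}"
      "D = zero_dist_rel r F `` {y}" "E = zero_dist_rel r F `` {z}"
      using CDE rep by meson
    then show ?thesis
      by (simp add: eq stable_dist_triangle[OF assms(1) ms ms ms])
  qed
qed

lemma mspace_metric_identification:
  "normalizing r \<Longrightarrow> self_stable r F \<Longrightarrow>
     mspace (metric_identification r F) = F // zero_dist_rel r F"
  unfolding metric_identification_def
  by (rule Metric_space.mspace_metric[OF Metric_space_identification])

lemma mdist_metric_identification:
  "normalizing r \<Longrightarrow> self_stable r F \<Longrightarrow>
     mdist (metric_identification r F) = class_dist r F"
  unfolding metric_identification_def
  by (rule Metric_space.mdist_metric[OF Metric_space_identification])

(* A self-stable family is recovered as the union of its equivalence classes, so a unique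
   pretangent space amounts to a unique maximal self-stable family. *)
lemma unique_pretangent_space_iff:
  assumes "normalizing r"
  shows "(\<exists>!\<Omega>. is_pretangent_space a r \<Omega>) \<longleftrightarrow>
         (\<exists>!F. maximal_self_stable r F \<and> (\<lambda>_. a) \<in> F)"
proof -
  have "F = \<Union> (mspace (metric_identification r F))" if "maximal_self_stable r F"
    for F :: "(nat \<Rightarrow> 'a) set"
  proof -
    have "self_stable r F"
      using that by (simp add: maximal_self_stable_def)
    then show ?thesis
      by (simp only: mspace_metric_identification[OF assms]
          Union_quotient[OF equiv_zero_dist_rel[OF assms]])
  qed
  then have inj: "F = G" if "maximal_self_stable r F" "maximal_self_stable r G"
    "metric_identification r F = metric_identification r G" for F G :: "(nat \<Rightarrow> 'a) set"
    using that by metis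
  show ?thesis
    unfolding is_pretangent_space_def
  proof
    assume "\<exists>!\<Omega>. \<exists>F. maximal_self_stable r F \<and> (\<lambda>_. a) \<in> F \<and> \<Omega> = metric_identification r F"
    with inj show "\<exists>!F. maximal_self_stable r F \<and> (\<lambda>_. a) \<in> F"
      by blast
  next
    assume "\<exists>!F. maximal_self_stable r F \<and> (\<lambda>_. a) \<in> F"
    then show "\<exists>!\<Omega>. \<exists>F. maximal_self_stable r F \<and> (\<lambda>_. a) \<in> F \<and> \<Omega> = metric_identification r F"
      by blast
  qed
qed

end

theory Submission
  imports Defs
begin

text \<open>
  By Zorn's lemma the pretangent space is unique iff any two sequences that are mutually stable
  with the constant sequence \<open>a\<close> are mutually stable with each other. Given this property,
  interleaving two sequences whose distances to \<open>a\<close> have the same limit forces their mutual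
  distance to be \<open>o(r\<^sub>n)\<close>, which is condition (i). Conversely, (i) says that points
  at comparable distance from \<open>a\<close> are indistinguishable up to \<open>o(r)\<close>, so that the
  distance between points of two separated spheres is determined, up to an error small compared
  to the gap between the radii, by the radii alone: this yields (ii), and it turns (iii) into the
  stability of sequences with distinct limits.
\<close>

section \<open>Stability through the marked point, and thin annuli\<close>

definition transitively_stable :: "(nat \<Rightarrow> real) \<Rightarrow> 'a::metric_space \<Rightarrow> bool" where
  "transitively_stable r a \<longleftrightarrow>
     (\<forall>x y. mutually_stable r x (\<lambda>_. a) \<and> mutually_stable r y (\<lambda>_. a) \<longrightarrow> mutually_stable r x y)"

text \<open>Quantifier form of condition (i), without the iterated limit or the diameter. One
  \<open>k\<close> for each \<open>\<epsilon>\<close> is enough because annuli grow with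
  \<open>k\<close>.\<close>

definition thin_annuli :: "'a::metric_space \<Rightarrow> bool" where
  "thin_annuli a \<longleftrightarrow>
     (\<forall>\<epsilon>>0. \<exists>k>1. \<exists>\<rho>>0. \<forall>r x y. 0 < r \<and> r < \<rho> \<and> x \<in> annulus a r k \<and> y \<in> annulus a r k
        \<longrightarrow> dist x y \<le> \<epsilon> * r)"

lemma thin_annuliE:
  assumes "thin_annuli a" "\<epsilon> > 0"
  obtains k \<rho> where "k > 1" "\<rho> > 0" "\<And>r x y. 0 < r \<Longrightarrow> r < \<rho> \<Longrightarrow> x \<in> annulus a r k \<Longrightarrow>
    y \<in> annulus a r k \<Longrightarrow> dist x y \<le> \<epsilon> * r"
proof -
  from assms obtain k \<rho> where "k > 1" "\<rho> > 0" "\<forall>r x y. 0 < r \<and> r < \<rho> \<and> x \<in> annulus a r k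
      \<and> y \<in> annulus a r k \<longrightarrow> dist x y \<le> \<epsilon> * r"
    unfolding thin_annuli_def by blast
  then show ?thesis by (intro that[of k \<rho>]) auto
qed

section \<open>Maximal self-stable families and their uniqueness\<close>

lemma mutually_stable_commute: "mutually_stable r x y \<longleftrightarrow> mutually_stable r y x"
  by (simp add: mutually_stable_def dist_commute)

lemma mutually_stable_self: "mutually_stable r x x"
  by (simp add: mutually_stable_def convergent_const)

text \<open>Zorn's lemma for the self-stable families above \<open>F\<close>: two sequences from the
  union of a chain already lie in one member of it. A family maximal for inclusion is
  \<open>maximal_self_stable\<close> because a sequence stable with all its members can be
  adjoined.\<close>

lemma self_stable_extends_to_maximal:
  assumes "self_stable r F"
  obtains G where "F \<subseteq> G" "maximal_self_stable r G"
proof -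
  let ?A = "{G. F \<subseteq> G \<and> self_stable r G}"
  have "\<exists>M\<in>?A. \<forall>X\<in>?A. M \<subseteq> X \<longrightarrow> X = M"
  proof (rule subset_Zorn_nonempty)
    show "?A \<noteq> {}" using assms by blast
    fix C assume C: "C \<noteq> {}" "subset.chain ?A C"
    have "mutually_stable r x y" if xy: "x \<in> \<Union>C" "y \<in> \<Union>C" for x y
    proof -
      obtain X Y where "X \<in> C" "x \<in> X" "Y \<in> C" "y \<in> Y" using xy by blast
      moreover from this C(2) have "X \<subseteq> Y \<or> Y \<subseteq> X" "self_stable r X" "self_stable r Y"
        by (auto simp: subset_chain_def)
      ultimately show ?thesis unfolding self_stable_def by blast
    qed
    moreover have "F \<subseteq> \<Union>C"
      using C unfolding subset_chain_def by blast
    ultimately show "\<Union>C \<in> ?A" by (simp add: self_stable_def)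
  qed
  then obtain M where "M \<in> ?A" and "\<forall>X\<in>?A. M \<subseteq> X \<longrightarrow> X = M" ..
  then have M: "F \<subseteq> M" "self_stable r M"
    and max: "\<And>X. F \<subseteq> X \<Longrightarrow> self_stable r X \<Longrightarrow> M \<subseteq> X \<Longrightarrow> X = M" by simp_all
  have "z \<in> M" if "\<forall>x\<in>M. mutually_stable r x z" for z
  proof -
    have "self_stable r (insert z M)"
      using M(2) that mutually_stable_self[of r z] mutually_stable_commute[of r _ z]
      unfolding self_stable_def by blast
    then have "insert z M = M" using M(1) by (intro max) auto
    then show ?thesis by blast
  qed
  then have "maximal_self_stable r M" using M(2) unfolding maximal_self_stable_def by blast
  with M(1) show ?thesis using that by blast
qed

text \<open>If the family is unique, it contains every sequence stable with \<open>a\<close>, since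
  the pair of that sequence and \<open>a\<close> extends to a maximal family. Conversely, under
  \<open>transitively_stable\<close> all sequences stable with \<open>a\<close> form one self-stable
  family, and every self-stable family through \<open>a\<close> is part of it.\<close>

lemma unique_maximal_self_stable_iff:
  "(\<exists>!F. maximal_self_stable r F \<and> (\<lambda>_. a) \<in> F) \<longleftrightarrow> transitively_stable r a" (is "?L \<longleftrightarrow> ?R")
proof
  assume L: ?L
  show ?R unfolding transitively_stable_def
  proof (intro allI impI)
    fix x y assume xy: "mutually_stable r x (\<lambda>_. a) \<and> mutually_stable r y (\<lambda>_. a)"
    have *: "\<exists>G. z \<in> G \<and> maximal_self_stable r G \<and> (\<lambda>_. a) \<in> G"
      if "mutually_stable r z (\<lambda>_. a)" for z
    proof -
      have "self_stable r {z, \<lambda>_. a}"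
        using that mutually_stable_self mutually_stable_commute[of r z "\<lambda>_. a"]
        unfolding self_stable_def by blast
      then show ?thesis by (rule self_stable_extends_to_maximal) auto
    qed
    with xy L obtain G where "x \<in> G" "y \<in> G" "maximal_self_stable r G" by metis
    then show "mutually_stable r x y" by (simp add: maximal_self_stable_def self_stable_def)
  qed
next
  assume R: ?R
  let ?F = "{x. mutually_stable r x (\<lambda>_. a)}"
  have a: "(\<lambda>_. a) \<in> ?F" by (simp add: mutually_stable_self)
  have "self_stable r ?F" using R unfolding self_stable_def transitively_stable_def by blast
  \<comment> \<open>For \<open>z\<close> outside \<open>?F\<close> the constant sequence
    \<open>a\<close> is the member with which stability fails.\<close>
  moreover have "z \<in> ?F \<or> (\<exists>x\<in>?F. \<not> mutually_stable r x z)" for z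
    using a mutually_stable_commute[of r z "\<lambda>_. a"] by blast
  ultimately have F: "maximal_self_stable r ?F" unfolding maximal_self_stable_def by blast
  have "G = ?F" if G: "maximal_self_stable r G" "(\<lambda>_. a) \<in> G" for G
  proof -
    have "G \<subseteq> ?F" using G by (auto simp: maximal_self_stable_def self_stable_def)
    moreover have "?F \<subseteq> G"
    proof
      fix z assume z: "z \<in> ?F"
      have "mutually_stable r x z" if "x \<in> G" for x
        using that z \<open>G \<subseteq> ?F\<close> R unfolding transitively_stable_def by blast
      then show "z \<in> G" using G(1) unfolding maximal_self_stable_def by blast
    qed
    ultimately show ?thesis by blast
  qed
  with F a show ?L by blast
qed

section \<open>Condition (i) as thinness of annuli\<close>

lemma bounded_annulus: "bounded (annulus a r k)"
  by (rule bounded_subset[OF bounded_cball[of a "r * k"]]) (auto simp: annulus_def dist_commute)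

lemma annulus_mono:
  assumes "0 < r" "1 \<le> k" "k \<le> l"
  shows "annulus a r k \<subseteq> annulus a r l"
proof -
  have "r / l \<le> r / k" using assms by (intro divide_left_mono) auto
  moreover have "r * k \<le> r * l" using assms by simp
  ultimately show ?thesis by (auto simp: annulus_def)
qed

text \<open>The limit in \<open>k\<close> provides one admissible \<open>k\<close> above 1;
  conversely, by monotonicity a bound at one \<open>l\<close> above 1 covers all \<open>k\<close>
  from 1 to \<open>l\<close>.\<close>

lemma diameter_annulus_tendsto_0_iff:
  "((\<lambda>k. Limsup (at 0 within {0<..}) (\<lambda>r. ereal (diameter (annulus a r k) / r))) \<longlongrightarrow> 0)
     (at 1 within {1..}) \<longleftrightarrow> thin_annuli a" (is "(?L \<longlongrightarrow> 0) ?F \<longleftrightarrow> _")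
proof
  assume lim: "(?L \<longlongrightarrow> 0) ?F"
  show "thin_annuli a" unfolding thin_annuli_def
  proof (intro allI impI)
    fix e :: real assume e: "e > 0"
    have "eventually (\<lambda>k. ?L k < ereal e) ?F"
      using order_tendstoD(2)[OF lim, of "ereal e"] e by simp
    then obtain d where d: "d > 0" "\<forall>k\<in>{1..}. k \<noteq> 1 \<and> dist k 1 < d \<longrightarrow> ?L k < ereal e"
      by (auto simp: eventually_at)
    \<comment> \<open>The filter excludes the point 1, so \<open>k\<close> has to lie strictly above
      1 and closer to it than \<open>d\<close>.\<close>
    define k where "k = 1 + d / 2"
    have k: "k > 1" "?L k < ereal e" using d by (auto simp: k_def dist_real_def)
    from Limsup_lessD[OF k(2)]
    obtain \<rho> where \<rho>: "\<rho> > 0" "\<And>r. 0 < r \<Longrightarrow> r < \<rho> \<Longrightarrow> diameter (annulus a r k) / r < e"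
      by (auto simp: eventually_at_right_field)
    have "dist x y \<le> e * r" if "0 < r \<and> r < \<rho> \<and> x \<in> annulus a r k \<and> y \<in> annulus a r k" for r x y
      using diameter_bounded_bound[OF bounded_annulus, of x a r k y] \<rho>(2)[of r] that
      by (simp add: field_simps)
    with k \<rho> show "\<exists>k>1. \<exists>\<rho>>0. \<forall>r x y. 0 < r \<and> r < \<rho> \<and> x \<in> annulus a r k \<and> y \<in> annulus a r k
        \<longrightarrow> dist x y \<le> e * r" by blast
  qed
next
  assume thin: "thin_annuli a"
  show "(?L \<longlongrightarrow> 0) ?F"
  proof (rule order_tendstoI)
    fix b :: ereal assume b: "b < 0"
    have "0 \<le> ?L k" for k
    proof (rule le_Limsup)
      show "\<forall>\<^sub>F r in at_right 0. 0 \<le> ereal (diameter (annulus a r k) / r)"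
        using diameter_ge_0[OF bounded_annulus, of a _ k] by (auto simp: eventually_at_right_field intro!: exI[of _ 1])
    qed simp
    then show "eventually (\<lambda>k. b < ?L k) ?F" using b by (auto intro: always_eventually less_le_trans)
  next
    fix b :: ereal assume b: "0 < b"
    \<comment> \<open>The bound by \<open>e\<close> survives the \<open>Limsup\<close> only as a
      weak inequality; \<open>e\<close> strictly below \<open>b\<close> restores strictness.\<close>
    obtain e :: real where e: "0 < e" "ereal e < b"
      using ereal_dense2[OF b] by (auto simp: zero_ereal_def)
    obtain l \<rho> where l: "l > 1" "\<rho> > 0" and le: "\<And>r x y. 0 < r \<Longrightarrow> r < \<rho> \<Longrightarrow> x \<in> annulus a r l
       \<Longrightarrow> y \<in> annulus a r l \<Longrightarrow> dist x y \<le> e * r"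
      by (rule thin_annuliE[OF thin e(1)]) (rule that; blast)
    have "?L k < b" if k: "k \<ge> 1" "k \<le> l" for k
    proof -
      have "diameter (annulus a r k) / r \<le> e" if r: "0 < r" "r < \<rho>" for r
      proof -
        have "diameter (annulus a r k) \<le> e * r"
        \<comment> \<open>The empty annulus has diameter 0 by definition, whereas
          \<open>cSUP_least\<close> needs a nonempty index set.\<close>
        proof (cases "annulus a r k = {}")
          case False
          show ?thesis unfolding diameter_def using False annulus_mono[OF r(1) k, of a] le[OF r]
            by (auto intro!: cSUP_least)
        qed (use e r in simp)
        then show ?thesis using r by (simp add: field_simps)
      qed
      then have "?L k \<le> ereal e"
        using l(2) by (intro Limsup_bounded) (auto simp: eventually_at_right_field)
      with e(2) show ?thesis by simp
    qed
    then show "eventually (\<lambda>k. ?L k < b) ?F"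
      unfolding eventually_at using l(1) by (intro exI[of _ "l - 1"]) (auto simp: dist_real_def)
  qed
qed

section \<open>Sequences at asymptotically equal distance from the marked point\<close>

text \<open>For positive \<open>c\<close> both sequences eventually enter the annulus of radius
  \<open>c * r n\<close> with a fixed \<open>k\<close>, where points are close relative to the
  radius. For \<open>c = 0\<close> the triangle inequality through \<open>a\<close>
  suffices.\<close>

lemma thin_annuli_imp_close:
  assumes thin: "thin_annuli a" and r: "normalizing r"
    and x: "(\<lambda>n. dist (x n) a / r n) \<longlonglongrightarrow> c" and y: "(\<lambda>n. dist (y n) a / r n) \<longlonglongrightarrow> c"
  shows "(\<lambda>n. dist (x n) (y n) / r n) \<longlonglongrightarrow> 0"
proof -
  have rpos: "r n > 0" for n using r by (simp add: normalizing_def)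
  have c: "c \<ge> 0" by (rule LIMSEQ_le_const[OF x]) (use rpos in \<open>auto simp: less_imp_le\<close>)
  show ?thesis
  proof (cases "c = 0")
    case True
    have le: "dist (x n) (y n) / r n \<le> dist (x n) a / r n + dist (y n) a / r n" for n
      using rpos[of n] dist_triangle2[of "x n" "y n" a]
      by (simp add: divide_right_mono flip: add_divide_distrib)
    show ?thesis
      by (rule tendsto_sandwich[OF _ _ tendsto_const, where h = "\<lambda>n. dist (x n) a / r n + dist (y n) a / r n"])
         (use le rpos tendsto_add[OF x y] True in \<open>auto simp: less_imp_le\<close>)
  next
    case False
    with c have c: "c > 0" by simp
    show ?thesis
    proof (rule tendstoI)
      fix e :: real assume e: "e > 0"
      \<comment> \<open>Times the annulus radius \<open>c * r n\<close>, this constant gives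
        \<open>e / 2 * r n\<close>, strictly below \<open>e * r n\<close>.\<close>
      have pos: "e / (2 * c) > 0" using e c by simp
      obtain k \<rho> where k: "k > 1" "\<rho> > 0" and le: "\<And>s x y. 0 < s \<Longrightarrow> s < \<rho> \<Longrightarrow> x \<in> annulus a s k
         \<Longrightarrow> y \<in> annulus a s k \<Longrightarrow> dist x y \<le> e / (2 * c) * s"
        by (rule thin_annuliE[OF thin pos]) (rule that; blast)
      have b: "c / k < c" "c < c * k" using c k by (auto simp: field_simps)
      have "(\<lambda>n. c * r n) \<longlonglongrightarrow> 0"
        using r by (auto simp: normalizing_def intro: tendsto_mult_right_zero)
      then have "eventually (\<lambda>n. c * r n < \<rho>) sequentially" using k by (auto dest: order_tendstoD)
      with order_tendstoD(1)[OF x b(1)] order_tendstoD(2)[OF x b(2)]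
        order_tendstoD(1)[OF y b(1)] order_tendstoD(2)[OF y b(2)]
      show "eventually (\<lambda>n. dist (dist (x n) (y n) / r n) 0 < e) sequentially"
      proof eventually_elim
        case (elim n)
        have "x n \<in> annulus a (c * r n) k" "y n \<in> annulus a (c * r n) k"
          using elim(1-4) rpos[of n] k by (auto simp: annulus_def field_simps)
        then have "dist (x n) (y n) \<le> e / (2 * c) * (c * r n)"
          using elim c rpos[of n] by (intro le) auto
        also have "\<dots> = e / 2 * r n" using c by simp
        also have "\<dots> < e * r n" using e rpos[of n] by simp
        finally show ?case using rpos[of n] by (simp add: dist_real_def field_simps)
      qed
    qed
  qed
qed

text \<open>Interleaving \<open>x\<close> and \<open>y\<close> gives a sequence \<open>z\<close>
  with the same limit \<open>c\<close>, so the scaled distances from \<open>x\<close> to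
  \<open>z\<close> converge. They vanish at even indices and agree with those from \<open>x\<close>
  to \<open>y\<close> at odd ones.\<close>

lemma transitively_stable_imp_close:
  assumes st: "transitively_stable r a"
    and x: "(\<lambda>n. dist (x n) a / r n) \<longlonglongrightarrow> c" and y: "(\<lambda>n. dist (y n) a / r n) \<longlonglongrightarrow> c"
  shows "(\<lambda>n. dist (x n) (y n) / r n) \<longlonglongrightarrow> 0"
proof -
  define z where "z n = (if even n then x n else y n)" for n
  have z: "(\<lambda>n. dist (z n) a / r n) \<longlonglongrightarrow> c"
  proof (rule tendstoI)
    fix e :: real assume "e > 0"
    from tendstoD[OF x this] tendstoD[OF y this]
    show "eventually (\<lambda>n. dist (dist (z n) a / r n) c < e) sequentially"
      by eventually_elim (simp add: z_def)
  qed
  have "mutually_stable r u (\<lambda>_. a)" if "(\<lambda>n. dist (u n) a / r n) \<longlonglongrightarrow> c" for u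
    using that by (auto simp: mutually_stable_def convergent_def)
  with x y z st have "mutually_stable r x z" "mutually_stable r x y"
    unfolding transitively_stable_def by blast+
  then obtain L1 L where L1: "(\<lambda>n. dist (x n) (z n) / r n) \<longlonglongrightarrow> L1"
    and L: "(\<lambda>n. dist (x n) (y n) / r n) \<longlonglongrightarrow> L"
    by (auto simp: mutually_stable_def convergent_def)
  have "(\<lambda>_::nat. 0) \<longlonglongrightarrow> L1"
    using LIMSEQ_subseq_LIMSEQ[OF L1, of "\<lambda>n. 2 * n"]
    by (simp add: strict_mono_def o_def z_def)
  then have "L1 = 0" by (simp add: LIMSEQ_const_iff)
  have odd: "strict_mono (\<lambda>n::nat. 2 * n + 1)" by (simp add: strict_mono_def)
  have "L = L1"
    using LIMSEQ_subseq_LIMSEQ[OF L1 odd] LIMSEQ_subseq_LIMSEQ[OF L odd]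
    by (simp add: o_def z_def LIMSEQ_unique)
  with L \<open>L1 = 0\<close> show ?thesis by simp
qed

text \<open>If thinness fails for some \<open>e\<close>, the offending radii form a normalizing
  sequence along which the offending points have scaled distance to \<open>a\<close> tending to 1,
  yet stay at least \<open>e * r n\<close> apart.\<close>

lemma transitively_stable_imp_thin_annuli:
  assumes st: "\<And>r. normalizing r \<Longrightarrow> transitively_stable r a"
  shows "thin_annuli a"
proof (rule ccontr)
  assume "\<not> thin_annuli a"
  then obtain e where e: "e > 0" and ex: "\<And>k \<rho>. k > 1 \<Longrightarrow> \<rho> > 0 \<Longrightarrow>
      \<exists>r x y. 0 < r \<and> r < \<rho> \<and> x \<in> annulus a r k \<and> y \<in> annulus a r k \<and> dist x y > e * r"
    unfolding thin_annuli_def by (meson not_le)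
  \<comment> \<open>Letting the width shrink to 1 together with the radius squeezes the scaled
    distances to \<open>a\<close> between \<open>1 / k n\<close> and \<open>k n\<close>.\<close>
  define k where "k n = 1 + inverse (real (Suc n))" for n
  have k: "k n > 1" for n by (simp add: k_def)
  have "\<forall>n. \<exists>r x y. 0 < r \<and> r < inverse (real (Suc n)) \<and> x \<in> annulus a r (k n)
      \<and> y \<in> annulus a r (k n) \<and> dist x y > e * r"
    using ex[OF k] by simp
  then obtain r x y where r: "\<And>n. 0 < r n" "\<And>n. r n < inverse (real (Suc n))"
    and xy: "\<And>n. x n \<in> annulus a (r n) (k n)" "\<And>n. y n \<in> annulus a (r n) (k n)"
    and far: "\<And>n. dist (x n) (y n) > e * r n" by metis
  have "r \<longlonglongrightarrow> 0"
    by (rule tendsto_sandwich[OF _ _ tendsto_const LIMSEQ_inverse_real_of_nat])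
       (use r in \<open>auto simp: less_imp_le\<close>)
  with r have nr: "normalizing r" by (simp add: normalizing_def)
  have klim: "k \<longlonglongrightarrow> 1"
    unfolding k_def using tendsto_add[OF tendsto_const[of 1] LIMSEQ_inverse_real_of_nat] by simp
  have kinv: "(\<lambda>n. 1 / k n) \<longlonglongrightarrow> 1"
    using tendsto_divide[OF tendsto_const[of 1] klim] by simp
  have lim: "(\<lambda>n. dist (u n) a / r n) \<longlonglongrightarrow> 1" if u: "\<And>n. u n \<in> annulus a (r n) (k n)" for u
  proof (rule tendsto_sandwich[OF _ _ kinv klim]; intro always_eventually allI)
    fix n
    have k0: "k n > 0" using k[of n] by simp
    have "r n / k n \<le> dist (u n) a" "dist (u n) a \<le> r n * k n"
      using u[of n] by (auto simp: annulus_def)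
    then show "1 / k n \<le> dist (u n) a / r n" "dist (u n) a / r n \<le> k n"
      using r(1)[of n] k0 by (simp_all add: field_simps)
  qed
  have "(\<lambda>n. dist (x n) (y n) / r n) \<longlonglongrightarrow> 0"
    by (rule transitively_stable_imp_close[OF st[OF nr] lim[OF xy(1)] lim[OF xy(2)]])
  moreover have "e \<le> dist (x n) (y n) / r n" for n
    using far[of n] r(1)[of n] by (simp add: field_simps)
  ultimately have "e \<le> 0" using LIMSEQ_le_const by blast
  with e show False by simp
qed

section \<open>Separated spheres and condition (ii)\<close>

lemma separated_radiiD:
  assumes "(q, t) \<in> separated_radii a \<epsilon>"
  shows "0 < q" "0 < t" "dist_sphere a q \<noteq> {}" "dist_sphere a t \<noteq> {}" "\<epsilon> * t \<le> \<bar>q - t\<bar>"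
    "\<epsilon> \<le> \<bar>q / t - 1\<bar>"
proof -
  show *: "0 < q" "0 < t" "dist_sphere a q \<noteq> {}" "dist_sphere a t \<noteq> {}" "\<epsilon> \<le> \<bar>q / t - 1\<bar>"
    using assms by (auto simp: separated_radii_def radii_def)
  \<comment> \<open>Multiplying by \<open>t\<close> turns separation of the ratio from 1 into a
    lower bound for the gap of the radii.\<close>
  have "\<bar>q - t\<bar> = \<bar>q / t - 1\<bar> * t" using *(2) by (simp add: abs_if field_simps)
  with *(2,5) show "\<epsilon> * t \<le> \<bar>q - t\<bar>" by (simp add: mult_right_mono)
qed

lemma sup_dist_commute: "sup_dist C D = sup_dist D C"
proof -
  have "(\<lambda>(x, y). dist x y) ` (C \<times> D) = (\<lambda>(x, y). dist x y) ` prod.swap ` (C \<times> D)"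
    by (simp add: image_image case_prod_unfold dist_commute)
  then show ?thesis by (simp add: sup_dist_def product_swap)
qed

text \<open>Distances between the spheres are at most \<open>q + t\<close> by the triangle
  inequality through \<open>a\<close>, so the real supremum is a genuine upper bound.\<close>

lemma dist_le_sup_dist:
  assumes "x \<in> dist_sphere a q" "y \<in> dist_sphere a t"
  shows "dist x y \<le> sup_dist (dist_sphere a q) (dist_sphere a t)"
proof -
  have "dist u v \<le> q + t" if "u \<in> dist_sphere a q" "v \<in> dist_sphere a t" for u v
    using that dist_triangle2[of u v a] by (simp add: dist_sphere_def)
  then have "bdd_above ((\<lambda>(x, y). dist x y) ` (dist_sphere a q \<times> dist_sphere a t))"
    by (intro bdd_aboveI[of _ "q + t"]) auto
  from cSUP_upper[OF _ this, of "(x, y)"] assms show ?thesis by (simp add: sup_dist_def)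
qed

text \<open>The key estimate: any two points of separated spheres realise the supremum up to a small
  fraction of the gap. Moving a point within its sphere costs little relative to its radius, and
  separation bounds both radii by a multiple of the gap.\<close>

lemma sup_dist_spheres_le:
  assumes thin: "thin_annuli a" and \<epsilon>: "0 < \<epsilon>" "\<epsilon> < 1" and \<eta>: "\<eta> > 0"
  obtains \<rho> where "\<rho> > 0" "\<And>q t x y. (q, t) \<in> separated_radii a \<epsilon> \<Longrightarrow> q < \<rho> \<Longrightarrow> t < \<rho> \<Longrightarrow>
     x \<in> dist_sphere a q \<Longrightarrow> y \<in> dist_sphere a t \<Longrightarrow>
     sup_dist (dist_sphere a q) (dist_sphere a t) \<le> dist x y + \<eta> * \<bar>q - t\<bar>"
proof -
  \<comment> \<open>The factor \<open>\<epsilon> / 3\<close> is dictated by the estimate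
    \<open>\<epsilon> * (q + t) \<le> 3 * \<bar>q - t\<bar>\<close> below.\<close>
  have pos: "\<eta> * \<epsilon> / 3 > 0" using \<epsilon> \<eta> by simp
  obtain k \<rho> where k: "k > 1" "\<rho> > 0" and le: "\<And>s x y. 0 < s \<Longrightarrow> s < \<rho> \<Longrightarrow> x \<in> annulus a s k
         \<Longrightarrow> y \<in> annulus a s k \<Longrightarrow> dist x y \<le> \<eta> * \<epsilon> / 3 * s"
    by (rule thin_annuliE[OF thin pos]) (rule that; blast)
  \<comment> \<open>A sphere of radius \<open>s\<close> lies in the annulus of radius
    \<open>s\<close>, as \<open>k\<close> exceeds 1.\<close>
  have diam: "dist x y \<le> \<eta> * \<epsilon> / 3 * s"
    if "0 < s" "s < \<rho>" "x \<in> dist_sphere a s" "y \<in> dist_sphere a s" for s x y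
    by (rule le) (use that k in \<open>auto simp: annulus_def dist_sphere_def field_simps\<close>)
  show ?thesis
  proof (rule that[OF k(2)])
    fix q t x y assume qt: "(q, t) \<in> separated_radii a \<epsilon>" "q < \<rho>" "t < \<rho>"
      and xy: "x \<in> dist_sphere a q" "y \<in> dist_sphere a t"
    note sep = separated_radiiD[OF qt(1)]
    \<comment> \<open>From \<open>q + t \<le> \<bar>q - t\<bar> + 2 * t\<close>; then
      \<open>\<epsilon> < 1\<close> bounds the first term and separation the second.\<close>
    have "\<epsilon> * (q + t) \<le> \<epsilon> * \<bar>q - t\<bar> + 2 * (\<epsilon> * t)"
      using mult_left_mono[of "q + t" "\<bar>q - t\<bar> + 2 * t" \<epsilon>] \<epsilon> by (simp add: algebra_simps)
    also have "\<dots> \<le> 3 * \<bar>q - t\<bar>"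
      using sep(5) mult_right_mono[of \<epsilon> 1 "\<bar>q - t\<bar>"] \<epsilon> by simp
    finally have "\<eta> * (\<epsilon> * (q + t)) \<le> \<eta> * (3 * \<bar>q - t\<bar>)"
      using \<eta> by (intro mult_left_mono) auto
    then have gap: "\<eta> * \<epsilon> / 3 * q + \<eta> * \<epsilon> / 3 * t \<le> \<eta> * \<bar>q - t\<bar>"
      by (simp add: algebra_simps)
    have "dist u v \<le> dist x y + \<eta> * \<bar>q - t\<bar>"
      if uv: "u \<in> dist_sphere a q" "v \<in> dist_sphere a t" for u v
    proof -
      have "dist u v \<le> dist u x + dist x y + dist y v"
        using dist_triangle[of u v x] dist_triangle[of x v y] by linarith
      with diam[OF sep(1) qt(2) uv(1) xy(1)] diam[OF sep(2) qt(3) xy(2) uv(2)] gap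
      show ?thesis by linarith
    qed
    then show "sup_dist (dist_sphere a q) (dist_sphere a t) \<le> dist x y + \<eta> * \<bar>q - t\<bar>"
      unfolding sup_dist_def using sep(3,4) by (intro cSUP_least) auto
  qed
qed

text \<open>Allows the supremum in condition (iii) to be exchanged for the distance between
  arbitrarily chosen points of the two spheres.\<close>

lemma thin_annuli_imp_sup_dist_close:
  assumes thin: "thin_annuli a" and \<epsilon>: "0 < \<epsilon>" "\<epsilon> < 1"
    and sep: "\<And>n. (q n, t n) \<in> separated_radii a \<epsilon>" and lim: "q \<longlonglongrightarrow> 0" "t \<longlonglongrightarrow> 0"
    and xy: "\<And>n. x n \<in> dist_sphere a (q n)" "\<And>n. y n \<in> dist_sphere a (t n)"
  shows "(\<lambda>n. sup_dist (dist_sphere a (q n)) (dist_sphere a (t n)) / \<bar>q n - t n\<bar>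
              - dist (x n) (y n) / \<bar>q n - t n\<bar>) \<longlonglongrightarrow> 0"
proof (rule tendstoI)
  fix e :: real assume e: "e > 0"
  then have "e / 2 > 0" by simp
  from sup_dist_spheres_le[OF thin \<epsilon> this]
  obtain \<rho> where \<rho>: "\<rho> > 0" "\<And>q t x y. (q, t) \<in> separated_radii a \<epsilon> \<Longrightarrow> q < \<rho> \<Longrightarrow> t < \<rho> \<Longrightarrow>
     x \<in> dist_sphere a q \<Longrightarrow> y \<in> dist_sphere a t \<Longrightarrow>
     sup_dist (dist_sphere a q) (dist_sphere a t) \<le> dist x y + e / 2 * \<bar>q - t\<bar>" by metis
  have "eventually (\<lambda>n. q n < \<rho>) sequentially" "eventually (\<lambda>n. t n < \<rho>) sequentially"
    using lim \<rho>(1) by (auto dest: order_tendstoD)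
  then show "eventually (\<lambda>n. dist (sup_dist (dist_sphere a (q n)) (dist_sphere a (t n)) / \<bar>q n - t n\<bar>
              - dist (x n) (y n) / \<bar>q n - t n\<bar>) 0 < e) sequentially"
  proof eventually_elim
    case (elim n)
    let ?S = "sup_dist (dist_sphere a (q n)) (dist_sphere a (t n))"
    have "0 < \<epsilon> * t n" using separated_radiiD(2)[OF sep[of n]] \<epsilon> by simp
    then have g: "\<bar>q n - t n\<bar> > 0" using separated_radiiD(5)[OF sep[of n]] by linarith
    have "?S - dist (x n) (y n) \<le> e / 2 * \<bar>q n - t n\<bar>" "dist (x n) (y n) \<le> ?S"
      using \<rho>(2)[OF sep elim xy] dist_le_sup_dist[OF xy] by auto
    then have "(?S - dist (x n) (y n)) / \<bar>q n - t n\<bar> \<le> e / 2" "0 \<le> (?S - dist (x n) (y n)) / \<bar>q n - t n\<bar>"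
      using g by (simp_all add: pos_divide_le_eq)
    then have "\<bar>(?S - dist (x n) (y n)) / \<bar>q n - t n\<bar>\<bar> < e" using e by linarith
    then show ?case by (simp add: dist_real_def diff_divide_distrib)
  qed
qed

text \<open>The infimum of the distances is at least the gap of the radii, so an error small against
  the gap is also small against the infimum.\<close>

lemma thin_annuli_imp_sup_dist_setdist_ratio:
  assumes thin: "thin_annuli a" and \<epsilon>: "0 < \<epsilon>" "\<epsilon> < 1"
  shows "((\<lambda>(t, g). sup_dist (dist_sphere a g) (dist_sphere a t)
                     / setdist (dist_sphere a g) (dist_sphere a t)) \<longlongrightarrow> 1)
            (at (0, 0) within separated_radii a \<epsilon>)"
proof (rule tendstoI)
  fix e :: real assume e: "e > 0"
  then have "e / 2 > 0" by simp
  from sup_dist_spheres_le[OF thin \<epsilon> this]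
  obtain \<rho> where \<rho>: "\<rho> > 0" "\<And>q t x y. (q, t) \<in> separated_radii a \<epsilon> \<Longrightarrow> q < \<rho> \<Longrightarrow> t < \<rho> \<Longrightarrow>
     x \<in> dist_sphere a q \<Longrightarrow> y \<in> dist_sphere a t \<Longrightarrow>
     sup_dist (dist_sphere a q) (dist_sphere a t) \<le> dist x y + e / 2 * \<bar>q - t\<bar>" by metis
  have main: "dist (sup_dist (dist_sphere a g) (dist_sphere a t)
                     / setdist (dist_sphere a g) (dist_sphere a t)) 1 < e"
    if tg: "(t, g) \<in> separated_radii a \<epsilon>" and small: "dist (t, g) (0, 0) < \<rho>" for t g
  proof -
    let ?s = "sup_dist (dist_sphere a g) (dist_sphere a t)"
    let ?d = "setdist (dist_sphere a g) (dist_sphere a t)"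
    note sep = separated_radiiD[OF tg]
    have tr: "t < \<rho>" "g < \<rho>"
      using small dist_fst_le[of "(t, g)" "(0, 0)"] dist_snd_le[of "(t, g)" "(0, 0)"]
      by (auto simp: dist_real_def)
    have "0 < \<epsilon> * g" using sep(2) \<epsilon> by simp
    then have gap: "\<bar>t - g\<bar> > 0" using sep(5) by linarith
    have dist_ge: "\<bar>t - g\<bar> \<le> dist u v" if "u \<in> dist_sphere a g" "v \<in> dist_sphere a t" for u v
      using that dist_triangle[of u a v] dist_triangle[of v a u]
      by (simp add: dist_sphere_def dist_commute)
    have d: "\<bar>t - g\<bar> \<le> ?d" by (rule le_setdistI) (use sep dist_ge in auto)
    \<comment> \<open>The key estimate holds for every pair of points, hence also for the infimum
      over all pairs.\<close>
    have "?s - e / 2 * \<bar>t - g\<bar> \<le> ?d"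
    proof (rule le_setdistI)
      fix u v assume "u \<in> dist_sphere a g" "v \<in> dist_sphere a t"
      \<comment> \<open>The separated pair is \<open>(t, g)\<close> while the spheres occur in the
        order \<open>g\<close>, \<open>t\<close>; both distances have to be swapped.\<close>
      with \<rho>(2)[OF tg tr, of v u] show "?s - e / 2 * \<bar>t - g\<bar> \<le> dist u v"
        by (simp add: sup_dist_commute dist_commute)
    qed (use sep in auto)
    moreover have "e / 2 * \<bar>t - g\<bar> \<le> e / 2 * ?d" using d e by (intro mult_left_mono) auto
    ultimately have s: "?s - ?d \<le> e / 2 * ?d" by linarith
    obtain u v where uv: "u \<in> dist_sphere a g" "v \<in> dist_sphere a t" using sep(3,4) by blast
    have "?d \<le> ?s" using setdist_le_dist[OF uv] dist_le_sup_dist[OF uv] by linarith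
    moreover have d0: "?d > 0" using d gap by linarith
    ultimately have "1 \<le> ?s / ?d" "?s / ?d - 1 \<le> e / 2" using s by (simp_all add: field_simps)
    then have "\<bar>?s / ?d - 1\<bar> < e" using e by linarith
    then show ?thesis by (simp add: dist_real_def)
  qed
  then show "\<forall>\<^sub>F p in at (0, 0) within separated_radii a \<epsilon>.
     dist (case p of (t, g) \<Rightarrow> sup_dist (dist_sphere a g) (dist_sphere a t)
                     / setdist (dist_sphere a g) (dist_sphere a t)) 1 < e"
    unfolding eventually_at using \<rho>(1) by (intro exI[of _ \<rho>]) auto
qed

section \<open>Condition (iii)\<close>

text \<open>For a finite limit the quotients are expanded by \<open>1 / t n\<close>, for an infinite
  one by \<open>1 / q n\<close>. In both cases the new denominator has a nonzero limit.\<close>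

lemma convergent_ratio_gap:
  fixes q t :: "nat \<Rightarrow> real"
  assumes pos: "\<And>n. 0 < q n" "\<And>n. 0 < t n" and \<epsilon>: "0 < \<epsilon>" and sep: "\<And>n. \<epsilon> \<le> \<bar>q n / t n - 1\<bar>"
    and lim: "(\<lambda>n. ereal (q n / t n)) \<longlonglongrightarrow> c"
  shows "convergent (\<lambda>n. q n / \<bar>q n - t n\<bar>)" "convergent (\<lambda>n. t n / \<bar>q n - t n\<bar>)"
proof -
  have "c \<ge> 0" by (rule LIMSEQ_le_const[OF lim]) (use pos in \<open>auto simp: less_imp_le\<close>)
  then consider l where "c = ereal l" | "c = \<infinity>" by (cases c) auto
  then have "convergent (\<lambda>n. q n / \<bar>q n - t n\<bar>) \<and> convergent (\<lambda>n. t n / \<bar>q n - t n\<bar>)"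
  proof cases
    case 1
    then have l: "(\<lambda>n. q n / t n) \<longlonglongrightarrow> l" using lim by simp
    have g: "(\<lambda>n. \<bar>q n / t n - 1\<bar>) \<longlonglongrightarrow> \<bar>l - 1\<bar>" by (intro tendsto_intros l)
    \<comment> \<open>Separation passes to the limit and keeps the denominator away from 0.\<close>
    then have "\<epsilon> \<le> \<bar>l - 1\<bar>" using sep by (intro LIMSEQ_le_const) auto
    then have "\<bar>l - 1\<bar> \<noteq> 0" using \<epsilon> by linarith
    from tendsto_divide[OF l g this] tendsto_divide[OF tendsto_const g this]
    have "(\<lambda>n. (q n / t n) / \<bar>q n / t n - 1\<bar>) \<longlonglongrightarrow> l / \<bar>l - 1\<bar>"
      "(\<lambda>n. 1 / \<bar>q n / t n - 1\<bar>) \<longlonglongrightarrow> 1 / \<bar>l - 1\<bar>" .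
    moreover have "\<bar>q n / t n - 1\<bar> = \<bar>q n - t n\<bar> / t n" for n
      using pos(2)[of n] by (simp add: abs_if field_simps)
    ultimately show ?thesis using pos by (auto simp: convergent_def less_imp_neq[THEN not_sym])
  next
    case 2
    then have "filterlim (\<lambda>n. q n / t n) at_top sequentially"
      using lim by (simp add: tendsto_PInfty_eq_at_top)
    then have "(\<lambda>n. inverse (q n / t n)) \<longlonglongrightarrow> 0" by (rule tendsto_inverse_0_at_top)
    then have l: "(\<lambda>n. t n / q n) \<longlonglongrightarrow> 0" by simp
    have g: "(\<lambda>n. \<bar>1 - t n / q n\<bar>) \<longlonglongrightarrow> \<bar>1 - 0\<bar>" by (intro tendsto_intros l)
    have "\<bar>1 - 0 :: real\<bar> \<noteq> 0" by simp
    from tendsto_divide[OF l g this] tendsto_divide[OF tendsto_const g this]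
    have "(\<lambda>n. (t n / q n) / \<bar>1 - t n / q n\<bar>) \<longlonglongrightarrow> 0 / \<bar>1 - 0\<bar>"
      "(\<lambda>n. 1 / \<bar>1 - t n / q n\<bar>) \<longlonglongrightarrow> 1 / \<bar>1 - 0\<bar>" .
    moreover have "\<bar>1 - t n / q n\<bar> = \<bar>q n - t n\<bar> / q n" for n
      using pos(1)[of n] by (simp add: abs_if field_simps)
    ultimately show ?thesis using pos by (auto simp: convergent_def less_imp_neq[THEN not_sym])
  qed
  then show "convergent (\<lambda>n. q n / \<bar>q n - t n\<bar>)" "convergent (\<lambda>n. t n / \<bar>q n - t n\<bar>)" by auto
qed

text \<open>The gaps \<open>\<bar>q n - t n\<bar>\<close> serve as normalizing sequence. Points
  chosen on the spheres are then stable with \<open>a\<close> by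
  \<open>convergent_ratio_gap\<close>, hence with each other, and their distance may be replaced by
  the supremum.\<close>

lemma transitively_stable_imp_convergent_sup_dist:
  assumes st: "\<And>r. normalizing r \<Longrightarrow> transitively_stable r a"
    and \<epsilon>: "0 < \<epsilon>" "\<epsilon> < 1" and sep: "\<And>n. (q n, t n) \<in> separated_radii a \<epsilon>"
    and lim: "q \<longlonglongrightarrow> 0" "t \<longlonglongrightarrow> 0" and c: "(\<lambda>n. ereal (q n / t n)) \<longlonglongrightarrow> c"
  shows "convergent (\<lambda>n. sup_dist (dist_sphere a (q n)) (dist_sphere a (t n)) / \<bar>q n - t n\<bar>)"
proof -
  have "\<forall>n. \<exists>x. x \<in> dist_sphere a (q n)" "\<forall>n. \<exists>y. y \<in> dist_sphere a (t n)"
    using separated_radiiD(3,4)[OF sep] by blast+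
  then obtain x y where xy: "\<And>n. x n \<in> dist_sphere a (q n)" "\<And>n. y n \<in> dist_sphere a (t n)" by metis
  note pos = separated_radiiD(1,2)[OF sep]
  define r where "r n = \<bar>q n - t n\<bar>" for n
  have "r n > 0" for n
    using separated_radiiD(5)[OF sep[of n]] mult_pos_pos[OF \<epsilon>(1) pos(2)[of n]] by (simp add: r_def)
  moreover have "r \<longlonglongrightarrow> 0"
    unfolding r_def using tendsto_rabs[OF tendsto_diff[OF lim]] by simp
  ultimately have "transitively_stable r a" by (intro st) (simp add: normalizing_def)
  moreover have "mutually_stable r x (\<lambda>_. a)" "mutually_stable r y (\<lambda>_. a)"
    using xy convergent_ratio_gap[OF pos \<epsilon>(1) separated_radiiD(6)[OF sep] c]
    by (simp_all add: mutually_stable_def r_def dist_sphere_def)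
  ultimately have "mutually_stable r x y" unfolding transitively_stable_def by blast
  then obtain L where "(\<lambda>n. dist (x n) (y n) / \<bar>q n - t n\<bar>) \<longlonglongrightarrow> L"
    by (auto simp: mutually_stable_def convergent_def r_def)
  from tendsto_add[OF thin_annuli_imp_sup_dist_close[OF
      transitively_stable_imp_thin_annuli[OF st] \<epsilon> sep lim xy] this]
  show ?thesis by (auto simp: convergent_def)
qed

text \<open>Let the scaled distances to \<open>a\<close> tend to \<open>\<alpha>\<close> and
  \<open>\<beta>\<close>. Equal limits are settled by \<open>thin_annuli_imp_close\<close> and a
  zero limit by the triangle inequality. For distinct positive limits the radii are eventually
  separated, and the assumed convergence, rescaled from the gap to \<open>r n\<close>, gives
  stability.\<close>

lemma transitively_stable_if_convergent_sup_dist: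
  fixes a :: "'a::metric_space"
  assumes thin: "thin_annuli a" and r: "normalizing r"
    and conv: "\<And>\<epsilon> q t c. 0 < \<epsilon> \<Longrightarrow> \<epsilon> < 1 \<Longrightarrow> (\<And>n. (q n, t n) \<in> separated_radii a \<epsilon>) \<Longrightarrow>
      q \<longlonglongrightarrow> 0 \<Longrightarrow> t \<longlonglongrightarrow> 0 \<Longrightarrow> 0 \<le> c \<Longrightarrow> (\<lambda>n. q n / t n) \<longlonglongrightarrow> c \<Longrightarrow>
      convergent (\<lambda>n. sup_dist (dist_sphere a (q n)) (dist_sphere a (t n)) / \<bar>q n - t n\<bar>)"
  shows "transitively_stable r a"
  unfolding transitively_stable_def
proof (intro allI impI)
  fix x y :: "nat \<Rightarrow> 'a"
  assume "mutually_stable r x (\<lambda>_. a) \<and> mutually_stable r y (\<lambda>_. a)"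
  then obtain \<alpha> \<beta> where x: "(\<lambda>n. dist (x n) a / r n) \<longlonglongrightarrow> \<alpha>"
    and y: "(\<lambda>n. dist (y n) a / r n) \<longlonglongrightarrow> \<beta>"
    by (auto simp: mutually_stable_def convergent_def)
  have rpos: "r n > 0" and r0: "r \<longlonglongrightarrow> 0" for n using r by (auto simp: normalizing_def)
  have nonneg: "0 \<le> \<alpha>" "0 \<le> \<beta>"
    by (rule LIMSEQ_le_const[OF x] LIMSEQ_le_const[OF y]; use rpos in \<open>auto simp: less_imp_le\<close>)+
  \<comment> \<open>A sequence at scaled distance tending to 0 behaves like \<open>a\<close> itself:
    the two triangle inequalities squeeze the quotient to \<open>c\<close>.\<close>
  have zero: "mutually_stable r u v" if u: "(\<lambda>n. dist (u n) a / r n) \<longlonglongrightarrow> c"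
    and v: "(\<lambda>n. dist (v n) a / r n) \<longlonglongrightarrow> 0" for u v :: "nat \<Rightarrow> 'a" and c
  proof -
    have "dist (u n) a / r n - dist (v n) a / r n \<le> dist (u n) (v n) / r n"
      "dist (u n) (v n) / r n \<le> dist (u n) a / r n + dist (v n) a / r n" for n
      using rpos[of n] dist_triangle2[of "u n" "v n" a] dist_triangle[of "u n" a "v n"]
      by (simp_all add: divide_right_mono flip: add_divide_distrib diff_divide_distrib)
    note le = this
    have "(\<lambda>n. dist (u n) a / r n - dist (v n) a / r n) \<longlonglongrightarrow> c"
      "(\<lambda>n. dist (u n) a / r n + dist (v n) a / r n) \<longlonglongrightarrow> c"
      using tendsto_diff[OF u v] tendsto_add[OF u v] by simp_all
    from tendsto_sandwich[OF _ _ this] le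
    have "(\<lambda>n. dist (u n) (v n) / r n) \<longlonglongrightarrow> c" by (auto intro: always_eventually)
    then show ?thesis by (auto simp: mutually_stable_def convergent_def)
  qed
  consider "\<alpha> = \<beta>" | "\<beta> = 0" | "\<alpha> = 0" | "\<alpha> \<noteq> \<beta>" "\<alpha> > 0" "\<beta> > 0" using nonneg by linarith
  then show "mutually_stable r x y"
  proof cases
    case 1
    then show ?thesis using thin_annuli_imp_close[OF thin r x] y
      by (auto simp: mutually_stable_def convergent_def)
  next
    case 2
    then show ?thesis using zero x y by blast
  next
    case 3
    then show ?thesis using zero x y mutually_stable_commute[of r x y] by blast
  next
    case 4
    \<comment> \<open>Half the distance of the limit ratio from 1, so that the ratios themselves are
      eventually separated; the cap \<open>1 / 2\<close> keeps \<open>\<epsilon>\<close> below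
      1.\<close>
    define \<epsilon> where "\<epsilon> = min (1 / 2) (\<bar>\<alpha> / \<beta> - 1\<bar> / 2)"
    have "\<bar>\<alpha> / \<beta> - 1\<bar> > 0" using 4 by simp
    then have \<epsilon>: "0 < \<epsilon>" "\<epsilon> < 1" "\<epsilon> < \<bar>\<alpha> / \<beta> - 1\<bar>" by (auto simp: \<epsilon>_def min_def)
    have "(\<lambda>n. (dist (x n) a / r n) / (dist (y n) a / r n)) \<longlonglongrightarrow> \<alpha> / \<beta>"
      using 4 by (intro tendsto_divide x y) auto
    then have ratio: "(\<lambda>n. dist (x n) a / dist (y n) a) \<longlonglongrightarrow> \<alpha> / \<beta>"
      using rpos by (simp add: less_imp_neq[THEN not_sym])
    have "(\<lambda>n. \<bar>dist (x n) a / dist (y n) a - 1\<bar>) \<longlonglongrightarrow> \<bar>\<alpha> / \<beta> - 1\<bar>"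
      by (intro tendsto_intros ratio)
    from order_tendstoD(1)[OF this \<epsilon>(3)] order_tendstoD(1)[OF x 4(2)] order_tendstoD(1)[OF y 4(3)]
    have "eventually (\<lambda>n. (dist (x n) a, dist (y n) a) \<in> separated_radii a \<epsilon>) sequentially"
      by eventually_elim (auto simp: separated_radii_def radii_def dist_sphere_def zero_less_divide_iff)
    then obtain N where N: "\<And>n. n \<ge> N \<Longrightarrow> (dist (x n) a, dist (y n) a) \<in> separated_radii a \<epsilon>"
      by (auto simp: eventually_sequentially)
    \<comment> \<open>Separation is required at every index but holds only from \<open>N\<close> on,
      hence the shift; \<open>LIMSEQ_offset\<close> undoes it at the end.\<close>
    define q where "q n = dist (x (n + N)) a" for n
    define t where "t n = dist (y (n + N)) a" for n
    have sep: "(q n, t n) \<in> separated_radii a \<epsilon>" for n using N by (simp add: q_def t_def)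
    have to0: "(\<lambda>n. dist (u (n + N)) a) \<longlonglongrightarrow> 0"
      if "(\<lambda>n. dist (u n) a / r n) \<longlonglongrightarrow> c" for u :: "nat \<Rightarrow> 'a" and c
    proof -
      have "(\<lambda>n. dist (u n) a / r n * r n) \<longlonglongrightarrow> c * 0" by (intro tendsto_mult that r0)
      then have "(\<lambda>n. dist (u n) a) \<longlonglongrightarrow> 0" using rpos by (simp add: less_imp_neq[THEN not_sym])
      then show ?thesis by (rule LIMSEQ_ignore_initial_segment)
    qed
    have lim: "q \<longlonglongrightarrow> 0" "t \<longlonglongrightarrow> 0" unfolding q_def t_def using to0 x y by blast+
    have "(\<lambda>n. q n / t n) \<longlonglongrightarrow> \<alpha> / \<beta>"
      unfolding q_def t_def by (rule LIMSEQ_ignore_initial_segment[OF ratio])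
    from conv[OF \<epsilon>(1,2) sep lim _ this] 4 obtain L where
      L: "(\<lambda>n. sup_dist (dist_sphere a (q n)) (dist_sphere a (t n)) / \<bar>q n - t n\<bar>) \<longlonglongrightarrow> L"
      by (auto simp: convergent_def)
    have "(\<lambda>n. sup_dist (dist_sphere a (q n)) (dist_sphere a (t n)) / \<bar>q n - t n\<bar>
              - dist (x (n + N)) (y (n + N)) / \<bar>q n - t n\<bar>) \<longlonglongrightarrow> 0"
      by (rule thin_annuli_imp_sup_dist_close[OF thin \<epsilon>(1,2) sep lim])
         (simp_all add: q_def t_def dist_sphere_def)
    from tendsto_diff[OF L this]
    have d: "(\<lambda>n. dist (x (n + N)) (y (n + N)) / \<bar>q n - t n\<bar>) \<longlonglongrightarrow> L" by simp
    \<comment> \<open>Conversion factor from the gap to \<open>r\<close>: multiplying by it cancels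
      the gap and leaves the quotient by \<open>r\<close>.\<close>
    have "(\<lambda>n. \<bar>q n / r (n + N) - t n / r (n + N)\<bar>) \<longlonglongrightarrow> \<bar>\<alpha> - \<beta>\<bar>"
      unfolding q_def t_def
      by (intro tendsto_rabs tendsto_diff LIMSEQ_ignore_initial_segment[OF x]
          LIMSEQ_ignore_initial_segment[OF y])
    from tendsto_mult[OF d this]
    have "(\<lambda>n. dist (x (n + N)) (y (n + N)) / \<bar>q n - t n\<bar> * \<bar>q n / r (n + N) - t n / r (n + N)\<bar>)
        \<longlonglongrightarrow> L * \<bar>\<alpha> - \<beta>\<bar>" .
    moreover have "dist (x (n + N)) (y (n + N)) / \<bar>q n - t n\<bar> * \<bar>q n / r (n + N) - t n / r (n + N)\<bar>
        = dist (x (n + N)) (y (n + N)) / r (n + N)" for n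
    proof -
      have "0 < \<epsilon> * t n" using separated_radiiD(2)[OF sep[of n]] \<epsilon>(1) by simp
      then have "\<bar>q n - t n\<bar> \<noteq> 0" using separated_radiiD(5)[OF sep[of n]] by linarith
      moreover have "\<bar>q n / r (n + N) - t n / r (n + N)\<bar> = \<bar>q n - t n\<bar> / r (n + N)"
        using rpos[of "n + N"] by (simp flip: diff_divide_distrib)
      ultimately show ?thesis by simp
    qed
    ultimately have "(\<lambda>n. dist (x (n + N)) (y (n + N)) / r (n + N)) \<longlonglongrightarrow> L * \<bar>\<alpha> - \<beta>\<bar>" by simp
    then have "(\<lambda>n. dist (x n) (y n) / r n) \<longlonglongrightarrow> L * \<bar>\<alpha> - \<beta>\<bar>" by (rule LIMSEQ_offset)
    then show ?thesis by (auto simp: mutually_stable_def convergent_def)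
  qed
qed

section \<open>Assembling the equivalence\<close>

theorem theorem2p4:
  fixes a :: "'a::metric_space"
  assumes "a islimpt UNIV"
  shows "(\<forall>r. normalizing r \<longrightarrow> (\<exists>!\<Omega>. is_pretangent_space a r \<Omega>)) \<longleftrightarrow>
    (((\<lambda>k. Limsup (at 0 within {0<..}) (\<lambda>r. ereal (diameter (annulus a r k) / r))) \<longlongrightarrow> 0)
        (at 1 within {1..})
     \<and> (\<forall>\<epsilon>. 0 < \<epsilon> \<and> \<epsilon> < 1 \<longrightarrow>
          ((\<lambda>(t, g). sup_dist (dist_sphere a g) (dist_sphere a t)
                     / setdist (dist_sphere a g) (dist_sphere a t)) \<longlongrightarrow> 1)
            (at (0, 0) within separated_radii a \<epsilon>))
     \<and> (\<forall>\<epsilon>. 0 < \<epsilon> \<and> \<epsilon> < 1 \<longrightarrow>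
          (\<forall>q t. (\<forall>n. (q n, t n) \<in> separated_radii a \<epsilon>)
             \<and> (\<lambda>n. (q n, t n)) \<longlonglongrightarrow> (0, 0)
             \<and> (\<exists>c\<in>{0..\<infinity>}. (\<lambda>n. ereal (q n / t n)) \<longlonglongrightarrow> c)
             \<longrightarrow> convergent (\<lambda>n. sup_dist (dist_sphere a (q n)) (dist_sphere a (t n))
                                  / \<bar>q n - t n\<bar>))))"
    (is "?A \<longleftrightarrow> ?i \<and> ?ii \<and> ?iii")
proof -
  \<comment> \<open>Uniqueness passes from spaces to maximal families and from these to stability
    through \<open>a\<close>, for each normalizing sequence separately.\<close>
  have A: "?A \<longleftrightarrow> (\<forall>r. normalizing r \<longrightarrow> transitively_stable r a)"
    by (simp add: unique_pretangent_space_iff unique_maximal_self_stable_iff)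
  have i: "?i \<longleftrightarrow> thin_annuli a" by (rule diameter_annulus_tendsto_0_iff)
  show ?thesis
  proof
    assume ?A
    with A have st: "normalizing r \<Longrightarrow> transitively_stable r a" for r by blast
    then have thin: "thin_annuli a" by (rule transitively_stable_imp_thin_annuli)
    have ?ii by (intro allI impI thin_annuli_imp_sup_dist_setdist_ratio[OF thin]) auto
    moreover have ?iii
    proof (intro allI impI)
      fix \<epsilon> :: real and q t :: "nat \<Rightarrow> real"
      assume \<epsilon>: "0 < \<epsilon> \<and> \<epsilon> < 1"
        and *: "(\<forall>n. (q n, t n) \<in> separated_radii a \<epsilon>) \<and> (\<lambda>n. (q n, t n)) \<longlonglongrightarrow> (0, 0)
             \<and> (\<exists>c\<in>{0..\<infinity>}. (\<lambda>n. ereal (q n / t n)) \<longlonglongrightarrow> c)"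
      have "q \<longlonglongrightarrow> 0" "t \<longlonglongrightarrow> 0"
        using tendsto_fst[of "\<lambda>n. (q n, t n)" "(0, 0)"] tendsto_snd[of "\<lambda>n. (q n, t n)" "(0, 0)"] *
        by simp_all
      moreover obtain c where "(\<lambda>n. ereal (q n / t n)) \<longlonglongrightarrow> c" using * by blast
      moreover have "\<And>n. (q n, t n) \<in> separated_radii a \<epsilon>" "0 < \<epsilon>" "\<epsilon> < 1"
        using * \<epsilon> by blast+
      ultimately show "convergent (\<lambda>n. sup_dist (dist_sphere a (q n)) (dist_sphere a (t n))
                                  / \<bar>q n - t n\<bar>)"
        by (intro transitively_stable_imp_convergent_sup_dist[OF st])
    qed
    ultimately show "?i \<and> ?ii \<and> ?iii" using thin i by blast
  next
    assume B: "?i \<and> ?ii \<and> ?iii"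
    then have thin: "thin_annuli a" and iii: ?iii using i by blast+
    have "transitively_stable r a" if "normalizing r" for r
    proof (rule transitively_stable_if_convergent_sup_dist[OF thin that])
      fix \<epsilon> c :: real and q t :: "nat \<Rightarrow> real"
      assume *: "0 < \<epsilon>" "\<epsilon> < 1" "\<And>n. (q n, t n) \<in> separated_radii a \<epsilon>" "q \<longlonglongrightarrow> 0" "t \<longlonglongrightarrow> 0"
        "0 \<le> c" "(\<lambda>n. q n / t n) \<longlonglongrightarrow> c"
      have "(\<lambda>n. (q n, t n)) \<longlonglongrightarrow> (0, 0)" by (intro tendsto_Pair *)
      \<comment> \<open>The finite limit ratio is read as an extended real, the form in which (iii)
        expects it.\<close>
      moreover have "\<exists>c\<in>{0..\<infinity>}. (\<lambda>n. ereal (q n / t n)) \<longlonglongrightarrow> c"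
        using * by (intro bexI[of _ "ereal c"]) auto
      ultimately show "convergent (\<lambda>n. sup_dist (dist_sphere a (q n)) (dist_sphere a (t n)) / \<bar>q n - t n\<bar>)"
        using *(1-3) by (intro iii[rule_format, of \<epsilon>]) simp_all
    qed
    with A show ?A by blast
  qed
qed

end
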